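(* Let $m\ge 3$ be an integer. There is an $EG(m,2)$ WOM code that achieves $4(m-2)$ writes and has parameters $$\langle \underbrace{2^m,\,2^m,\,2^m,\,2^m-4,\;2^{m-1},\,2^{m-1},\,2^{m-1},\,2^{m-1}-4,\;\ldots,\;8,\,8,\,8,\,4}_{4(m-2)}\rangle/2^m ;$$ that is, the list of message numbers is the concatenation, for $j=0,1,\ldots,m-3$, of the blocks $(2^{m-j},\,2^{m-j},\,2^{m-j},\,2^{m-j}-4)$.
   Context: A write-once memory (WOM) consists of $n$ binary cells, initially all $0$, in which a $0$ may be changed to a $1$ but a $1$ can never be changed back to a $0$. The content of the memory is the cell state vector in $\mathbb{F}_2^n$. A WOM code consists of a set of messages, a set of cell state vectors (the codewords), a decoding map sending each such cell state vector to the message it represents, and an encoding rule which, given the current cell state vector and a new message, outputs a cell state vector that represents the new message and is componentwise at least the current one. Only the most recently written message is retained, and if the new message equals the message currently represented, the memory may be left unchanged. The notation $\langle v_1,\ldots,v_t\rangle/n$ denotes a $t$-write WOM code on $n$ cells in which $v_i$ is the number of messages that can be represented on the $i$-th write (in every cell state reachable after $i-1$ writes, the code allows $v_i$ messages to be written on the $i$-th write; which messages these are may depend on the current cell state). $EG(m,2)$ is the $m$-dimensional Euclidean geometry over $\mathbb{F}_2$, whose points are the $2^m$ elements of $\mathbb{F}_2^m$ and whose $\mu$-flats are the cosets of the $\mu$-dimensional linear subspaces of $\mathbb{F}_2^m$. $\mathcal{R}(m-2,m)$ is the binary Reed-Muller code of order $m-2$ and length $2^m$, with coordinates indexed by the points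 of $EG(m,2)$; it is generated by the incidence vectors of the planes ($2$-flats) of $EG(m,2)$ and has minimum distance $4$. An $EG(m,2)$ WOM code is a WOM code on $n=2^m$ cells indexed by the points of $EG(m,2)$, whose messages correspond to points of $EG(m,2)$, and in which each cell state vector used to represent a message is at Hamming distance exactly one from a codeword of $\mathcal{R}(m-2,m)$. The message represented by such a cell state vector is the point indexing the coordinate in which it differs from that codeword (this coordinate is unique and is found by syndrome decoding). *)

theory Defs
  imports "HOL-Analysis.Analysis" "HOL-Library.Z2"
begin

instance bit :: finite
proof
  have "(UNIV :: bit set) \<subseteq> {0, 1}"
    using bit.exhaust by auto
  then show "finite (UNIV :: bit set)"
    by (rule finite_subset) simp
qed

section \<open>Write-once memory codes\<close>

text \<open>The cells are indexed by a finite type \<open>'n\<close>, so that the cell state vectors have type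
  \<open>bit ^ 'n\<close>. The encoding rule is partial: \<open>None\<close> means that the message cannot be written in
  the given state. The all-zero initial state need not represent a message.\<close>

record ('n, 'msg) wom_code =
  messages :: "'msg set"
  codewords :: "(bit ^ 'n) set"
  decode :: "bit ^ 'n \<Rightarrow> 'msg"
  encode :: "bit ^ 'n \<Rightarrow> 'msg \<Rightarrow> (bit ^ 'n) option"

definition write_once :: "bit ^ 'n \<Rightarrow> bit ^ 'n \<Rightarrow> bool" where
  "write_once s s' \<longleftrightarrow> (\<forall>x. s $ x = 1 \<longrightarrow> s' $ x = 1)"

definition is_wom_code :: "('n::finite, 'msg) wom_code \<Rightarrow> bool" where
  "is_wom_code C \<longleftrightarrow>
     (\<forall>s \<in> codewords C. decode C s \<in> messages C) \<and>
     (\<forall>s \<in> insert 0 (codewords C). \<forall>q \<in> messages C. \<forall>s'. encode C s q = Some s' \<longrightarrow>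
        s' \<in> codewords C \<and> decode C s' = q \<and> write_once s s')"

text \<open>\<open>A i s\<close> is the set of messages that may be written next when the memory is in state \<open>s\<close>
  after \<open>i\<close> writes.\<close>

inductive wom_reachable ::
  "('n::finite, 'msg) wom_code \<Rightarrow> (nat \<Rightarrow> bit ^ 'n \<Rightarrow> 'msg set) \<Rightarrow> nat \<Rightarrow> bit ^ 'n \<Rightarrow> bool"
  for C A where
  "wom_reachable C A 0 0"
| "wom_reachable C A i s \<Longrightarrow> q \<in> A i s \<Longrightarrow> encode C s q = Some s'
     \<Longrightarrow> wom_reachable C A (Suc i) s'"

text \<open>The parameters \<open>\<langle>v\<^sub>1, \<dots>, v\<^sub>t\<rangle> / n\<close>, with \<open>vs = [v\<^sub>1, \<dots>, v\<^sub>t]\<close>; the list is indexed from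
  \<open>0\<close>, so \<open>vs ! i\<close> belongs to the write that follows \<open>i\<close> earlier ones.\<close>

definition wom_parameters :: "('n::finite, 'msg) wom_code \<Rightarrow> nat list \<Rightarrow> nat \<Rightarrow> bool" where
  "wom_parameters C vs n \<longleftrightarrow> CARD('n) = n \<and>
     (\<exists>A. \<forall>i < length vs. \<forall>s. wom_reachable C A i s \<longrightarrow>
        finite (A i s) \<and> card (A i s) = vs ! i \<and>
        A i s \<subseteq> {q \<in> messages C. encode C s q \<noteq> None})"

section \<open>Reed--Muller codes and Euclidean geometry codes\<close>

text \<open>The points of \<open>EG(m,2)\<close> are the elements of \<open>bit ^ 'm\<close> with \<open>m = CARD('m)\<close>. The code
  \<open>\<R>(r,m)\<close> consists of the value vectors of the polynomials of degree at most \<open>r\<close>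
  in \<open>m\<close> variables over \<open>bit\<close>; square-free monomials suffice, since \<open>x\<^sup>2 = x\<close> on \<open>bit\<close>.\<close>

definition monomial_vector :: "'m set \<Rightarrow> bit ^ (bit ^ 'm::finite)" where
  "monomial_vector S = (\<chi> x. \<Prod>i\<in>S. x $ i)"

definition reed_muller :: "nat \<Rightarrow> (bit ^ (bit ^ 'm::finite)) set" where
  "reed_muller r = vec.span {monomial_vector S | S. card S \<le> r}"

definition hamming_dist :: "'a ^ 'n \<Rightarrow> 'a ^ 'n \<Rightarrow> nat" where
  "hamming_dist u v = card {x. u $ x \<noteq> v $ x}"

definition is_EG_wom_code :: "(bit ^ 'm::finite, bit ^ 'm) wom_code \<Rightarrow> bool" where
  "is_EG_wom_code C \<longleftrightarrow> is_wom_code C \<and> messages C = UNIV \<and>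
     (\<forall>s \<in> codewords C.
        (\<exists>c \<in> reed_muller (CARD('m) - 2). hamming_dist s c = 1) \<and>
        (\<forall>c \<in> reed_muller (CARD('m) - 2). hamming_dist s c = 1 \<longrightarrow>
           s $ decode C s \<noteq> c $ decode C s))"

definition EG_parameter_list :: "nat \<Rightarrow> nat list" where
  "EG_parameter_list m =
     concat (map (\<lambda>j. [2 ^ (m - j), 2 ^ (m - j), 2 ^ (m - j), 2 ^ (m - j) - 4]) [0..<m - 2])"

end

theory Submission
  imports Defs
begin

text \<open>The code \<open>\<R>(m - 2, m)\<close> consists of the vectors of even weight whose support sums to \<open>0\<close> in
  \<open>bit ^ 'm\<close>. Hence the states at distance one from it are exactly the vectors of odd weight, and
  such a state represents the sum of its support. Setting two further cells \<open>x\<close> and \<open>y\<close> adds \<open>x + y\<close>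
  to the message, so with \<open>F\<close> the set of free cells every message in a translate of \<open>F + F\<close> can be
  written. Since \<open>2 |F| > 2 ^ k\<close> forces \<open>|F + F| \<ge> 2 ^ k\<close>, and after \<open>i > 0\<close> writes at most \<open>2 i - 1\<close>
  cells are used, the required numbers of messages follow by counting.\<close>


section \<open>Sumsets in binary vector spaces\<close>

declare add_bit_eq_xor [simp del] mult_bit_eq_and [simp del]

lemma bit_add_self [simp]: "a + a = (0 :: bit)"
  by (cases a) auto

lemma card_UNIV_bit [simp]: "CARD(bit) = 2"
proof -
  have "CARD(bit) = card {0 :: bit, 1}"
    by (rule arg_cong[where f = card]) (use bit.exhaust in auto)
  then show ?thesis by simp
qed

lemma bit_eq_add_1_iff: "b = c + 1 \<longleftrightarrow> b \<noteq> (c :: bit)"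
  by (cases b; cases c) auto

lemma bit_vec_add_self [simp]: "v + v = (0 :: bit ^ 'n)"
  by (simp add: vec_eq_iff)

text \<open>Split both sets along a coordinate on which the smaller one, \<open>B\<close>, is not constant. Each half of
  \<open>A + B\<close> contains two sums of halves, and one of them satisfies the hypothesis for \<open>k - 1\<close>.\<close>

lemma card_set_plus_ge_power2:
  fixes A B :: "(bit ^ 'n::finite) set"
  assumes "A \<noteq> {}" "B \<noteq> {}" "2 ^ k < card A + card B"
  shows "2 ^ k \<le> card (A + B)"
  using assms
proof (induction k arbitrary: A B)
  case 0
  then have "A + B \<noteq> {}" by (auto simp: set_plus_def)
  then show ?case by (simp add: Suc_le_eq card_gt_0_iff)
next
  case (Suc k)
  have larger_left: "2 ^ Suc k \<le> card (P + Q)"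
    if "P \<noteq> {}" "Q \<noteq> {}" "2 ^ Suc k < card P + card Q" "card Q \<le> card P" for P Q :: "(bit ^ 'n) set"
  proof (cases "card Q = 1")
    case True
    then obtain b where "Q = {b}" by (auto simp: card_1_singleton_iff)
    then have "P + Q = (\<lambda>a. a + b) ` P" by (auto simp: set_plus_def)
    then have "card (P + Q) = card P" by (simp add: card_image inj_on_def)
    then show ?thesis using that True by simp
  next
    case False
    then obtain x y where xy: "x \<in> Q" "y \<in> Q" "x \<noteq> y"
      using \<open>Q \<noteq> {}\<close> by (metis is_singletonI' is_singleton_altdef)
    then obtain i where i: "x $ i \<noteq> y $ i" by (auto simp: vec_eq_iff)
    define X where "X c R = {p \<in> R. p $ i = c}" for c and R :: "(bit ^ 'n) set"
    have split: "card R = card (X c R) + card (X (c + 1) R)" for c R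
    proof -
      have "R = X c R \<union> X (c + 1) R"
        by (auto simp: X_def bit_eq_add_1_iff)
      then have "card R = card (X c R \<union> X (c + 1) R)" by (rule arg_cong)
      also have "\<dots> = card (X c R) + card (X (c + 1) R)"
        by (rule card_Un_disjoint) (auto simp: X_def bit_eq_add_1_iff)
      finally show ?thesis .
    qed
    have ne: "X c Q \<noteq> {}" for c
    proof -
      have "x $ i = c \<or> y $ i = c" using i by (cases "x $ i"; cases "y $ i"; cases c) auto
      with xy show ?thesis by (auto simp: X_def)
    qed
    have half: "2 ^ k \<le> card (X c (P + Q))" for c
    proof -
      have "\<exists>a. X a P \<noteq> {} \<and> 2 ^ k < card (X a P) + card (X (a + c) Q)"
      proof (cases "\<exists>a. X a P = {}")
        case True
        then obtain a where "X a P = {}" by blast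
        then have "card (X (a + 1) P) = card P" using split[of P a] by simp
        \<comment> \<open>\<open>P\<close> is the larger set, so it holds more than half of
          \<open>2 ^ Suc k\<close> on its own.\<close>
        moreover have "2 ^ k < card P" using that by simp
        ultimately show ?thesis by (intro exI[of _ "a + 1"]) auto
      next
        case False
        \<comment> \<open>Pigeonhole: the four slices form two pairs whose coordinates add up to
          \<open>c\<close>, and one pair has more than \<open>2 ^ k\<close> elements.\<close>
        have "card P = card (X 0 P) + card (X 1 P)" "card Q = card (X (0 + c) Q) + card (X (1 + c) Q)"
          using split[of P 0] split[of Q c] by (simp_all add: add.commute)
        with that(3) have "2 ^ k < card (X 0 P) + card (X (0 + c) Q) \<or> 2 ^ k < card (X 1 P) + card (X (1 + c) Q)"
          unfolding power_Suc by linarith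
        with False show ?thesis by meson
      qed
      then obtain a where a: "X a P \<noteq> {}" "2 ^ k < card (X a P) + card (X (a + c) Q)" by blast
      have "2 ^ k \<le> card (X a P + X (a + c) Q)" by (rule Suc.IH[OF a(1) ne a(2)])
      also have "X a P + X (a + c) Q \<subseteq> X c (P + Q)"
        by (auto simp: X_def set_plus_def simp flip: add.assoc)
      then have "card (X a P + X (a + c) Q) \<le> card (X c (P + Q))" by (simp add: card_mono)
      finally show ?thesis .
    qed
    show ?thesis using half[of 0] half[of 1] split[of "P + Q" 0] by simp
  qed
  show ?case
  proof (cases "card B \<le> card A")
    case True
    then show ?thesis by (intro larger_left Suc.prems)
  next
    case False
    then show ?thesis using larger_left[of B A] Suc.prems by (simp add: add.commute)
  qed
qed

section \<open>Parity checks of the Reed-Muller code\<close>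

definition parity :: "bit ^ 'n::finite \<Rightarrow> bit" where
  "parity s = (\<Sum>x\<in>UNIV. s $ x)"

text \<open>Together with \<open>parity\<close>, this is the syndrome of the extended Hamming code,
  which is the Reed-Muller code of order \<open>m - 2\<close>.\<close>

definition syndrome :: "bit ^ (bit ^ 'm::finite) \<Rightarrow> bit ^ 'm" where
  "syndrome s = (\<Sum>x\<in>UNIV. s $ x *s x)"

definition weight :: "bit ^ 'n::finite \<Rightarrow> nat" where
  "weight s = card {x. s $ x = 1}"

lemma parity_eq_weight: "parity s = of_nat (weight s)"
proof -
  have "parity s = (\<Sum>x\<in>UNIV. of_bool (s $ x = 1))"
    unfolding parity_def by (intro sum.cong refl) (auto simp: )
  also have "\<dots> = of_nat (weight s)" by (simp add: weight_def)
  finally show ?thesis .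
qed

lemma parity_eq_1_iff: "parity s = 1 \<longleftrightarrow> odd (weight s)"
  by (cases "odd (weight s)") (auto simp: parity_eq_weight elim!: evenE oddE)

lemma parity_0 [simp]: "parity 0 = 0"
  by (simp add: parity_def)

lemma syndrome_0 [simp]: "syndrome 0 = 0"
  by (simp add: syndrome_def)

lemma parity_add: "parity (s + t) = parity s + parity t"
  by (simp add: parity_def sum.distrib)

lemma syndrome_add: "syndrome (s + t) = syndrome s + syndrome t"
  by (simp add: syndrome_def sum.distrib vector_sadd_rdistrib)

lemma parity_axis [simp]: "parity (axis p 1) = 1"
  by (simp add: parity_def axis_def)

lemma syndrome_axis [simp]: "syndrome (axis p 1) = p"
proof -
  have "syndrome (axis p 1) = (\<Sum>x\<in>UNIV. if x = p then x else 0)"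
    unfolding syndrome_def axis_def by (intro sum.cong) auto
  then show ?thesis by simp
qed

lemma syndrome_nth: "syndrome s $ i = (\<Sum>x\<in>UNIV. s $ x * x $ i)"
  by (simp add: syndrome_def)

text \<open>A variable \<open>j\<close> outside \<open>S\<close> does not affect the monomial, so
  flipping it pairs up equal values, which cancel over \<open>bit\<close>.\<close>

lemma parity_monomial_vector:
  assumes "S \<noteq> UNIV"
  shows "parity (monomial_vector S :: bit ^ (bit ^ 'm::finite)) = 0"
proof -
  obtain j where j: "j \<notin> S" using assms by blast
  let ?f = "\<lambda>x :: bit ^ 'm. \<Prod>i\<in>S. x $ i"
  have inv: "?f (x + axis j 1) = ?f x" for x
    using j by (intro prod.cong) (auto simp: axis_def)
  have "(\<Sum>x | x $ j = 1. ?f x) = (\<Sum>x | x $ j = 0. ?f x)"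
    by (rule sum.reindex_bij_witness[where i = "\<lambda>x. x + axis j 1" and j = "\<lambda>x. x + axis j 1"])
      (auto simp: inv simp del: vector_add_component, auto simp: axis_def vec_eq_iff)
  moreover have "sum ?f UNIV = (\<Sum>x | x $ j = 1. ?f x) + sum ?f (UNIV - {x. x $ j = 1})"
    using sum.subset_diff[of "{x. x $ j = 1}" UNIV ?f] by (simp add: add.commute)
  moreover have "UNIV - {x :: bit ^ 'm. x $ j = 1} = {x. x $ j = 0}" by auto
  ultimately show ?thesis by (simp add: parity_def monomial_vector_def)
qed

text \<open>Since coordinates are idempotent, multiplying by one more of them yields another
  square-free monomial; syndromes thus reduce to parities.\<close>

lemma syndrome_monomial_vector_nth:
  "syndrome (monomial_vector S) $ i = parity (monomial_vector (insert i S))"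
proof -
  have "(\<Prod>k\<in>S. x $ k) * x $ i = (\<Prod>k\<in>insert i S. x $ k)" for x :: "bit ^ 'a"
    by (cases "i \<in> S") (auto simp: insert_absorb prod.remove mult.commute)
  then show ?thesis by (simp add: syndrome_nth parity_def monomial_vector_def)
qed


lemma parity_scale: "parity (a *s s) = a * parity s"
  by (simp add: parity_def sum_distrib_left)

lemma syndrome_scale: "syndrome (a *s s) = a *s syndrome s"
  by (simp add: syndrome_def vec.scale_sum_right)

text \<open>A monomial of degree at most \<open>m - 2\<close> still misses a variable after
  multiplication by one coordinate. The bound on the dimension keeps the truncated subtraction
  exact.\<close>

lemma reed_muller_subset:
  assumes "CARD('m::finite) \<ge> 2"
  shows "reed_muller (CARD('m) - 2) \<subseteq> {c :: bit ^ (bit ^ 'm). parity c = 0 \<and> syndrome c = 0}"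
  unfolding reed_muller_def
proof (rule vec.span_minimal)
  show "vec.subspace {c :: bit ^ (bit ^ 'm). parity c = 0 \<and> syndrome c = 0}"
    by (rule vec.subspaceI) (auto simp: parity_add syndrome_add parity_scale syndrome_scale)
  show "{monomial_vector S | S. card S \<le> CARD('m) - 2} \<subseteq> {c :: bit ^ (bit ^ 'm). parity c = 0 \<and> syndrome c = 0}"
  proof clarify
    fix S :: "'m set" assume S: "card S \<le> CARD('m) - 2"
    have "insert i S \<noteq> UNIV" for i
      using S assms card_insert_le_m1[of "CARD('m) - 1" S i] by (auto simp: numeral_2_eq_2)
    moreover from this have "S \<noteq> UNIV" by auto
    ultimately show "parity (monomial_vector S) = 0 \<and> syndrome (monomial_vector S) = 0"
      by (simp add: vec_eq_iff syndrome_monomial_vector_nth parity_monomial_vector)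
  qed
qed

text \<open>The coefficient of a monomial of degree \<open>m\<close> is the parity of \<open>s\<close>; those of degree \<open>m - 1\<close> are
  the coordinates of the syndrome plus the parity.\<close>

lemma monomial_expansion:
  fixes s :: "bit ^ (bit ^ 'm::finite)"
  shows "s = (\<Sum>S\<in>UNIV. (\<Sum>p\<in>UNIV. s $ p * (\<Prod>i\<in>UNIV - S. p $ i + 1)) *s monomial_vector S)"
proof -
  \<comment> \<open>Multiplying out this indicator of \<open>p = x\<close> gives the monomials in
    \<open>x\<close>, with the coefficients of the expansion.\<close>
  have delta: "(\<Prod>i\<in>UNIV. x $ i + (p $ i + 1)) = of_bool (p = x)" for p x :: "bit ^ 'm"
  proof (cases "p = x")
    case True
    then show ?thesis by (simp flip: add.assoc)
  next
    case False
    then obtain i where "p $ i \<noteq> x $ i" by (auto simp: vec_eq_iff)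
    then have "x $ i + (p $ i + 1) = 0" by (cases "p $ i"; cases "x $ i") auto
    then show ?thesis using False by (auto intro!: prod_zero)
  qed
  have "(\<Sum>S\<in>UNIV. (\<Sum>p\<in>UNIV. s $ p * (\<Prod>i\<in>UNIV - S. p $ i + 1)) *s monomial_vector S) $ x = s $ x" for x
  proof -
    have "(\<Sum>S\<in>UNIV. (\<Sum>p\<in>UNIV. s $ p * (\<Prod>i\<in>UNIV - S. p $ i + 1)) *s monomial_vector S) $ x
      = (\<Sum>S\<in>UNIV. \<Sum>p\<in>UNIV. s $ p * ((\<Prod>i\<in>S. x $ i) * (\<Prod>i\<in>UNIV - S. p $ i + 1)))"
      by (simp add: monomial_vector_def sum_distrib_left sum_distrib_right mult_ac)
    also have "\<dots> = (\<Sum>p\<in>UNIV. s $ p * (\<Sum>S\<in>UNIV. (\<Prod>i\<in>S. x $ i) * (\<Prod>i\<in>UNIV - S. p $ i + 1)))"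
      by (subst sum.swap) (simp add: sum_distrib_left)
    also have "\<dots> = (\<Sum>p\<in>UNIV. s $ p * (\<Prod>i\<in>UNIV. x $ i + (p $ i + 1)))"
      by (simp add: prod_add)
    also have "\<dots> = (\<Sum>p\<in>UNIV. if p = x then s $ p else 0)"
      by (simp only: delta) (auto intro: sum.cong)
    finally show ?thesis by simp
  qed
  then show ?thesis by (simp only: vec_eq_iff) simp
qed

text \<open>For the converse inclusion, the two checks annihilate exactly the coefficients of
  degrees \<open>m\<close> and \<open>m - 1\<close> in the monomial expansion.\<close>

lemma reed_muller_eq:
  assumes "CARD('m::finite) \<ge> 2"
  shows "reed_muller (CARD('m) - 2) = {c :: bit ^ (bit ^ 'm). parity c = 0 \<and> syndrome c = 0}"
proof (intro equalityI reed_muller_subset assms subsetI)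
  fix c :: "bit ^ (bit ^ 'm)" assume "c \<in> {c. parity c = 0 \<and> syndrome c = 0}"
  then have c: "parity c = 0" "syndrome c = 0" by auto
  have "(\<Sum>p\<in>UNIV. c $ p * (\<Prod>i\<in>UNIV - S. p $ i + 1)) *s monomial_vector S \<in> reed_muller (CARD('m) - 2)"
    for S :: "'m set"
  proof (cases "card S \<le> CARD('m) - 2")
    case True
    then show ?thesis
      unfolding reed_muller_def by (intro vec.span_scale vec.span_base) blast
  next
    case False
    then have "card (UNIV - S) \<le> 1" by (simp add: card_Diff_subset)
    then consider "UNIV - S = {}" | i where "UNIV - S = {i}"
      by (metis card_1_singletonE card_0_eq finite le_less less_one)
    then have "(\<Sum>p\<in>UNIV. c $ p * (\<Prod>i\<in>UNIV - S. p $ i + 1)) = 0"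
    proof cases
      case 1
      then have "S = UNIV" by auto
      then show ?thesis using c(1) by (simp add: parity_def)
    next
      case (2 i)
      have "(\<Sum>p\<in>UNIV. c $ p * p $ i) = 0" "(\<Sum>p\<in>UNIV. c $ p) = 0"
        using c by (simp_all add: parity_def flip: syndrome_nth)
      with 2 show ?thesis by (simp add: distrib_left sum.distrib)
    qed
    then show ?thesis by (simp add: reed_muller_def vec.span_zero)
  qed
  then show "c \<in> reed_muller (CARD('m) - 2)"
    by (subst monomial_expansion) (auto simp: reed_muller_def intro!: vec.span_sum)
qed

section \<open>The code and its encoder\<close>

text \<open>The weight bound also covers the first write: from the zero state, odd weight at most \<open>2\<close>
  forces a single cell to be set.\<close>

definition next_states :: "bit ^ (bit ^ 'm::finite) \<Rightarrow> bit ^ 'm \<Rightarrow> (bit ^ (bit ^ 'm)) set" where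
  "next_states s q =
     {t. write_once s t \<and> odd (weight t) \<and> syndrome t = q \<and> weight t \<le> weight s + 2}"

text \<open>Any choice of the next state will do: the later counts use only its odd weight and the
  bound on that weight.\<close>

definition syndrome_code :: "(bit ^ 'm::finite, bit ^ 'm) wom_code" where
  "syndrome_code =
     \<lparr>messages = UNIV, codewords = {s. odd (weight s)}, decode = syndrome,
      encode = (\<lambda>s q. if next_states s q = {} then None else Some (SOME t. t \<in> next_states s q))\<rparr>"

lemma encode_syndrome_code_eq_None_iff [simp]:
  "encode syndrome_code s q = None \<longleftrightarrow> next_states s q = {}"
  by (simp add: syndrome_code_def)

lemma encode_syndrome_code_in_next_states:
  "encode syndrome_code s q = Some t \<Longrightarrow> t \<in> next_states s q"
  by (auto simp: syndrome_code_def some_in_eq split: if_splits)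

lemma is_EG_wom_code_syndrome_code:
  assumes "CARD('m::finite) \<ge> 2"
  shows "is_EG_wom_code (syndrome_code :: (bit ^ 'm, bit ^ 'm) wom_code)"
  unfolding is_EG_wom_code_def
proof (intro conjI ballI impI)
  show "is_wom_code (syndrome_code :: (bit ^ 'm, bit ^ 'm) wom_code)"
    unfolding is_wom_code_def
    by (auto dest!: encode_syndrome_code_in_next_states simp: next_states_def)
      (simp_all add: syndrome_code_def)
  show "messages (syndrome_code :: (bit ^ 'm, bit ^ 'm) wom_code) = UNIV"
    by (simp add: syndrome_code_def)
next
  fix s :: "bit ^ (bit ^ 'm)" assume "s \<in> codewords syndrome_code"
  then have s: "parity s = 1" by (simp add: syndrome_code_def parity_eq_1_iff)
  \<comment> \<open>Flipping the represented cell makes both parity and syndrome vanish.\<close>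
  let ?c = "s + axis (syndrome s) 1"
  have "?c \<in> reed_muller (CARD('m) - 2)"
    using s by (simp add: reed_muller_eq[OF assms] parity_add syndrome_add)
  moreover have "{x. s $ x \<noteq> ?c $ x} = {syndrome s}"
    by (auto simp: axis_def)
  then have "hamming_dist s ?c = 1" by (simp add: hamming_dist_def)
  ultimately show "\<exists>c \<in> reed_muller (CARD('m) - 2). hamming_dist s c = 1" by blast
next
  fix s c :: "bit ^ (bit ^ 'm)"
  assume c: "c \<in> reed_muller (CARD('m) - 2)" and "hamming_dist s c = 1"
  then obtain p where p: "{x. s $ x \<noteq> c $ x} = {p}"
    by (auto simp: hamming_dist_def card_1_singleton_iff)
  have "s $ x = (c + axis p 1) $ x" for x
  proof (cases "x = p")
    case True
    then have "s $ x \<noteq> c $ x" using p by blast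
    with True show ?thesis by (simp add: axis_def bit_eq_add_1_iff)
  next
    case False
    then have "s $ x = c $ x" using p by blast
    with False show ?thesis by (simp add: axis_def)
  qed
  then have "s = c + axis p 1" by (simp only: vec_eq_iff) simp
  then have "syndrome s = p" using c by (simp add: reed_muller_eq[OF assms] syndrome_add)
  then show "s $ decode syndrome_code s \<noteq> c $ decode syndrome_code s"
    using p by (auto simp: syndrome_code_def)
qed

section \<open>Counting the writable messages\<close>

lemma axis_in_next_states_0: "axis q 1 \<in> next_states 0 q"
proof -
  have "weight (axis q 1 :: bit ^ (bit ^ 'a)) = 1"
    by (simp add: weight_def axis_def)
  then show ?thesis by (simp add: next_states_def write_once_def)
qed

text \<open>The case \<open>x = y\<close> is included: nothing changes, and the current message is
  written again.\<close>

lemma set_two_cells_in_next_states: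
  assumes "odd (weight s)" "s $ x = 0" "s $ y = 0"
  shows "s + axis x 1 + axis y 1 \<in> next_states s (x + y + syndrome s)"
proof -
  let ?t = "s + axis x 1 + axis y 1"
  have "write_once s ?t" using assms by (auto simp: write_once_def axis_def)
  moreover have "odd (weight ?t)"
    using assms(1) by (simp add: parity_add add.assoc flip: parity_eq_1_iff)
  moreover have "syndrome ?t = x + y + syndrome s" by (simp add: syndrome_add add_ac)
  moreover have "{z. ?t $ z = 1} \<subseteq> {z. s $ z = 1} \<union> {x, y}" by (auto simp: axis_def)
  then have "weight ?t \<le> card ({z. s $ z = 1} \<union> {x, y})" unfolding weight_def by (simp add: card_mono)
  then have "weight ?t \<le> weight s + 2"
    using card_Un_le[of "{z. s $ z = 1}" "{x, y}"] card_insert_le_m1[of 2 "{y}" x]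
    by (simp add: weight_def)
  ultimately show ?thesis by (simp add: next_states_def)
qed

lemma card_writable_ge:
  fixes s :: "bit ^ (bit ^ 'm::finite)"
  assumes "odd (weight s)" "2 ^ k < 2 * (2 ^ CARD('m) - weight s)"
  shows "2 ^ k \<le> card {q. next_states s q \<noteq> {}}"
proof -
  let ?F = "{x. s $ x = 0}"
  have "?F = UNIV - {x. s $ x = 1}" by auto
  then have "card ?F = 2 ^ CARD('m) - weight s"
    by (simp add: card_Diff_subset weight_def)
  with assms(2) have F: "2 ^ k < card ?F + card ?F" by simp
  then have "?F \<noteq> {}" by force
  with F have "2 ^ k \<le> card (?F + ?F)" by (intro card_set_plus_ge_power2)
  \<comment> \<open>Translation by the current message turns differences into messages and is
    injective.\<close>
  also have "\<dots> = card ((\<lambda>d. d + syndrome s) ` (?F + ?F))"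
    by (simp add: card_image inj_on_def)
  also have "\<dots> \<le> card {q. next_states s q \<noteq> {}}"
    using set_two_cells_in_next_states[OF assms(1)] by (intro card_mono) (force simp: set_plus_def)+
  finally show ?thesis .
qed

lemma wom_reachable_syndrome_code:
  assumes "wom_reachable syndrome_code A i s"
  shows "weight s \<le> 2 * i \<and> (if i = 0 then s = 0 else odd (weight s))"
  using assms
proof induction
  case 1
  then show ?case by (simp add: weight_def)
next
  case (2 i s q s')
  from encode_syndrome_code_in_next_states[OF this(3)] 2 show ?case
    by (simp add: next_states_def)
qed

lemma EG_parameter_list_eq:
  "EG_parameter_list m =
     map (\<lambda>i. 2 ^ (m - i div 4) - (if i mod 4 = 3 then 4 else 0)) [0..<4 * (m - 2)]"
proof -
  have "concat (map (\<lambda>j. [2 ^ (m - j), 2 ^ (m - j), 2 ^ (m - j), 2 ^ (m - j) - 4]) [0..<n]) =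
     map (\<lambda>i. 2 ^ (m - i div 4) - (if i mod 4 = 3 then 4 else 0 :: nat)) [0..<4 * n]" for n
  proof (induction n)
    case (Suc n)
    have "[0..<4 * Suc n] = [0..<4 * n] @ [4 * n, 4 * n + 1, 4 * n + 2, 4 * n + 3]"
      by (simp add: numeral_eq_Suc)
    moreover have "Suc (4 * n) div 4 = n" "Suc (Suc (4 * n)) div 4 = n" by presburger+
    ultimately show ?case using Suc by (simp add: mod_Suc)
  qed simp
  then show ?thesis by (simp add: EG_parameter_list_def)
qed

lemma EG_parameter_bound:
  fixes i w m :: nat
  assumes "odd w" "w \<le> 2 * i" "i < 4 * (m - 2)"
  shows "\<exists>k. 2 ^ k < 2 * (2 ^ m - w) \<and>
    2 ^ (m - i div 4) - (if i mod 4 = 3 then 4 else 0) \<le> (2 :: nat) ^ k"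
proof -
  define j where "j = i div 4"
  define k where "k = m - j"
  have i: "i = 4 * j + i mod 4" by (simp add: j_def)
  have j: "j < m - 2" using assms(3) by (simp add: j_def)
  \<comment> \<open>Oddness makes the bound strict, and this one cell is what saves the tight
    cases.\<close>
  have w: "w < 2 * i" using assms by (metis dvd_triv_left le_neq_implies_less)
  have k: "k \<ge> 3" using j by (simp add: k_def)
  then have "2 ^ 3 \<le> (2 :: nat) ^ k" by (intro power_increasing) auto
  then have k8: "8 \<le> (2 :: nat) ^ k" by simp
  have "(2 :: nat) ^ m = 2 ^ j * 2 ^ k" using j by (simp add: k_def flip: power_add)
  \<comment> \<open>From \<open>j + 1 \<le> 2 ^ j\<close>: the \<open>8 * j\<close> cells charged to
    completed blocks leave room for \<open>2 ^ k\<close> more.\<close>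
  moreover have "(j + 1) * 2 ^ k \<le> 2 ^ j * (2 :: nat) ^ k"
    using Suc_leI[OF less_exp[of j]] by (intro mult_right_mono) (simp_all del: less_exp)
  moreover have "j * 8 \<le> j * 2 ^ k" using k8 by (rule mult_le_mono2)
  ultimately have m: "8 * j + 2 ^ k \<le> (2 :: nat) ^ m"
    by (simp only: add_mult_distrib)
  show ?thesis
  \<comment> \<open>Only in the very last write does the reduction by \<open>4\<close> matter: three cells may be all that is
    left then.\<close>
  proof (cases "i mod 4 = 3 \<and> k = 3")
    case True
    then have "2 ^ 2 < 2 * (2 ^ m - w)" using m w i by simp
    then show ?thesis using True by (intro exI[of _ 2]) (simp flip: k_def j_def)
  next
    case False
    have "2 ^ k < 2 * (2 ^ m - w)"
    proof (cases "i mod 4 = 3")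
      case True
      with False k have "k \<ge> 4" by simp
      then have "2 ^ 4 \<le> (2 :: nat) ^ k" by (intro power_increasing) auto
      then show ?thesis using m w i True by simp
    next
      case False
      then have "i mod 4 \<le> 2" by presburger
      then show ?thesis using m w i k8 by simp
    qed
    then show ?thesis by (intro exI[of _ k]) (simp flip: k_def j_def)
  qed
qed

theorem proposition2p8:
  fixes m :: nat
  assumes "m = CARD('m::finite)" and "m \<ge> 3"
  shows "length (EG_parameter_list m) = 4 * (m - 2) \<and>
    (\<exists>C :: (bit ^ 'm, bit ^ 'm) wom_code.
       is_EG_wom_code C \<and> wom_parameters C (EG_parameter_list m) (2 ^ m))"
proof -
  let ?C = "syndrome_code :: (bit ^ 'm, bit ^ 'm) wom_code"
  let ?vs = "EG_parameter_list m"
  let ?W = "\<lambda>s. {q :: bit ^ 'm. next_states s q \<noteq> {}}"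
  \<comment> \<open>Counting gives only a lower bound, whereas the parameters demand exact sizes, so
    a subset of the right size is chosen.\<close>
  define A where "A i s = (SOME B. B \<subseteq> ?W s \<and> card B = ?vs ! i)" for i s
  have len: "length ?vs = 4 * (m - 2)" by (simp add: EG_parameter_list_eq)
  have "A i s \<subseteq> ?W s \<and> card (A i s) = ?vs ! i"
    if i: "i < length ?vs" and s: "wom_reachable ?C A i s" for i s
  proof -
    have nth: "?vs ! i = 2 ^ (m - i div 4) - (if i mod 4 = 3 then 4 else 0)"
      using i len by (simp add: EG_parameter_list_eq)
    have "?vs ! i \<le> card (?W s)"
    \<comment> \<open>The zero state has even weight, so the first write sets a single cell, and
      every message is available.\<close>
    proof (cases "i = 0")
      case True
      then have "s = 0" using wom_reachable_syndrome_code[OF s] by simp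
      then have "?W s = UNIV" using axis_in_next_states_0 by blast
      then show ?thesis using True nth assms(1) by simp
    next
      case False
      then have w: "odd (weight s)" "weight s \<le> 2 * i"
        using wom_reachable_syndrome_code[OF s] by auto
      obtain k where "2 ^ k < 2 * (2 ^ m - weight s)" "?vs ! i \<le> 2 ^ k"
        using EG_parameter_bound[OF w] i len nth by auto
      then show ?thesis using card_writable_ge[OF w(1)] assms(1) by (metis order_trans)
    qed
    then obtain B where "B \<subseteq> ?W s" "card B = ?vs ! i"
      by (metis obtain_subset_with_card_n)
    then show ?thesis unfolding A_def by (intro someI[of "\<lambda>B. B \<subseteq> ?W s \<and> card B = ?vs ! i"]) simp
  qed
  then have "wom_parameters ?C ?vs (2 ^ m)"
    unfolding wom_parameters_def
    by (auto simp: assms(1) syndrome_code_def intro!: exI[of _ A])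
  moreover have "is_EG_wom_code ?C" using assms by (intro is_EG_wom_code_syndrome_code) simp
  ultimately show ?thesis using len by blast
qed

end
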